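(* Let $k\ge 1$ and let $A$ be a $k\times k$ complex matrix whose characteristic polynomial is $$P(s)=(s-\lambda_1)(s-\lambda_2)\cdots(s-\lambda_k),$$ where the eigenvalues $\lambda_1,\dots,\lambda_k$ are all distinct. For $0\le j\le k-1$ let $G_j(z)=\sum_{n\ge 0}b_j(n+k)\frac{z^n}{n!}$. Then for every $0\le j\le k-1$ and all $z$, $$G_j(z)=-\sum_{l=1}^{k}\lambda_l^{\,k-j-1}\,\frac{p_j(\lambda_l)}{P'(\lambda_l)}\,\exp(\lambda_l z),$$ and for every $0\le j\le k-1$ and every integer $n\ge k$, $$b_j(n)=-\sum_{l=1}^{k}\lambda_l^{\,n-j-1}\,\frac{p_j(\lambda_l)}{P'(\lambda_l)}.$$
   Context: Write the characteristic polynomial of the $k\times k$ matrix $A$ as $P(x)=x^{k}+\sum_{j=0}^{k-1}a_jx^{j}$. The numbers $b_j(n)$, for $0\le j\le k-1$ and integers $n\ge k$, are defined recursively by $b_j(k)=-a_j$ for $0\le j\le k-1$, the convention $b_{-1}(n)=0$ for $n\ge k$, and $b_j(n+1)=b_{j-1}(n)-a_j\,b_{k-1}(n)$ for $n\ge k$, $0\le j\le k-1$. (They satisfy $A^n=\sum_{j=0}^{k-1}b_j(n)A^j$ for $n\ge k$.) The polynomials $p_j$ are $p_j(s)=\sum_{l=0}^{j}a_l s^{l}$, $0\le j\le k-1$. Here $z$ is a complex variable, and $0^0=1$. *)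

theory Defs
  imports Complex_Main "Jordan_Normal_Form.Char_Poly"
begin

(* In all definitions below, a 0, ..., a (k - 1) are the non-leading coefficients of a
   monic polynomial of degree k. *)

(* b_shift k a m j is b_j(k + m); the case j = 0 encodes the convention b_{-1}(n) = 0. *)
primrec b_shift :: "nat \<Rightarrow> (nat \<Rightarrow> complex) \<Rightarrow> nat \<Rightarrow> nat \<Rightarrow> complex" where
  "b_shift k a 0 j = - a j"
| "b_shift k a (Suc m) j =
     (if j = 0 then 0 else b_shift k a m (j - 1)) - a j * b_shift k a m (k - 1)"

(* Only meaningful for n \<ge> k and j < k. *)
definition b_coeff :: "nat \<Rightarrow> (nat \<Rightarrow> complex) \<Rightarrow> nat \<Rightarrow> nat \<Rightarrow> complex" where
  "b_coeff k a j n = b_shift k a (n - k) j"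

lemma b_coeff_initial: "b_coeff k a j k = - a j"
  by (simp add: b_coeff_def)

lemma b_coeff_rec:
  assumes "n \<ge> k"
  shows "b_coeff k a j (n + 1) = (if j = 0 then 0 else b_coeff k a (j - 1) n) - a j * b_coeff k a (k - 1) n"
  using assms by (simp add: b_coeff_def Suc_diff_le)

definition p_trunc :: "(nat \<Rightarrow> complex) \<Rightarrow> nat \<Rightarrow> complex \<Rightarrow> complex" where
  "p_trunc a j s = (\<Sum>l=0..j. a l * s ^ l)"

definition G_gen :: "nat \<Rightarrow> (nat \<Rightarrow> complex) \<Rightarrow> nat \<Rightarrow> complex \<Rightarrow> complex" where
  "G_gen k a j z = (\<Sum>n. b_coeff k a j (n + k) * (z ^ n / fact n))"

end

theory Submission
  imports Defs
begin

text \<open>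
  The closed form for \<open>b_coeff\<close> comes from two facts. The first is Euler's identity
  \<open>sum_div_pderiv_eq_coeff\<close>: if \<open>P\<close> is monic of degree \<open>k\<close> with simple roots
  \<open>\<lambda>\<^sub>1, ..., \<lambda>\<^sub>k\<close> and \<open>deg Q < k\<close>, then \<open>\<Sum>\<^sub>l Q(\<lambda>\<^sub>l) / P'(\<lambda>\<^sub>l)\<close> is the coefficient of
  \<open>x\<^sup>k\<^sup>-\<^sup>1\<close> in \<open>Q\<close>; it is read off from the Lagrange interpolation formula. Applied to
  \<open>Q = x\<^sup>k\<^sup>-\<^sup>j\<^sup>-\<^sup>1 p\<^sub>j(x)\<close>, whose coefficient at \<open>x\<^sup>k\<^sup>-\<^sup>1\<close> is \<open>a\<^sub>j\<close>, it yields the initial values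
  \<open>b\<^sub>j(k) = -a\<^sub>j\<close>. The second is that the right-hand side obeys the recursion: one has
  \<open>p\<^sub>j(s) = p\<^sub>j\<^sub>-\<^sub>1(s) + a\<^sub>j s\<^sup>j\<close>, and \<open>P(\<lambda>\<^sub>l) = 0\<close> says that
  \<open>p\<^sub>k\<^sub>-\<^sub>1(\<lambda>\<^sub>l) = -\<lambda>\<^sub>l\<^sup>k\<close>. This is the induction in \<open>b_shift_closed_form\<close>.

  Since \<open>j < k\<close>, only nonnegative powers of the roots occur, and the argument covers a root
  equal to \<open>0\<close>. The generating function is then a finite sum of exponential series.
\<close>

lemma pderiv_prod_linear_at_root:
  fixes x :: "'i \<Rightarrow> 'a::field"
  assumes "finite I" and "l \<in> I"
  shows "poly (pderiv (\<Prod>i\<in>I. [:- x i, 1:])) (x l) = (\<Prod>i\<in>I - {l}. x l - x i)"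
proof -
  have "poly (pderiv (\<Prod>i\<in>I. [:- x i, 1:])) (x l)
      = (\<Sum>m\<in>I. \<Prod>i\<in>I - {m}. x l - x i)"
    by (simp add: pderiv_prod poly_sum poly_prod pderiv_pCons)
  also have "\<dots> = (\<Sum>m\<in>{l}. \<Prod>i\<in>I - {m}. x l - x i)"
    using assms by (intro sum.mono_neutral_right) (auto simp: prod_zero_iff)
  finally show ?thesis by simp
qed

text \<open>
  The Lagrange basis polynomials are \<open>\<Prod>\<^sub>i\<^sub>\<noteq>\<^sub>l (x - x\<^sub>i) / P'(x\<^sub>l)\<close>, each with leading
  coefficient \<open>1 / P'(x\<^sub>l)\<close> in degree \<open>k - 1\<close>. Comparing the coefficients of degree \<open>k - 1\<close>
  in the interpolation formula for \<open>Q\<close> gives the identity.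
\<close>
lemma sum_div_pderiv_eq_coeff:
  fixes x :: "'i \<Rightarrow> 'a::field" and Q :: "'a poly"
  assumes fin: "finite I" and inj: "inj_on x I" and deg: "degree Q < card I"
  defines "P \<equiv> (\<Prod>i\<in>I. [:- x i, 1:])"
  shows "(\<Sum>l\<in>I. poly Q (x l) / poly (pderiv P) (x l)) = coeff Q (card I - 1)"
proof -
  define B where "B l = (\<Prod>i\<in>I - {l}. [:- x i, 1:])" for l
  define c where "c l = poly Q (x l) / poly (pderiv P) (x l)" for l
  have degB: "degree (B l) = card I - 1" if "l \<in> I" for l
    using that fin by (simp add: B_def degree_prod_eq_sum_degree)
  have leadB: "coeff (B l) (card I - 1) = 1" if "l \<in> I" for l
    using degB[OF that] lead_coeff_prod[of "\<lambda>i. [:- x i, 1:]" "I - {l}"]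
    by (simp add: B_def)
  have B_node: "poly (B l) (x m) = (if m = l then poly (pderiv P) (x l) else 0)"
    if "l \<in> I" "m \<in> I" for l m
    using that fin
    by (auto simp: B_def P_def poly_prod pderiv_prod_linear_at_root prod_zero_iff)
  have P'_nz: "poly (pderiv P) (x l) \<noteq> 0" if "l \<in> I" for l
    using that fin inj
    by (auto simp: P_def pderiv_prod_linear_at_root prod_zero_iff dest: inj_onD)
  have interpolation: "Q = (\<Sum>l\<in>I. Polynomial.smult (c l) (B l))"
  proof (rule poly_eqI_degree[of "x ` I"])
    fix y assume "y \<in> x ` I"
    then obtain m where m: "m \<in> I" "y = x m" by blast
    have "poly (\<Sum>l\<in>I. Polynomial.smult (c l) (B l)) y
        = (\<Sum>l\<in>I. if m = l then c l * poly (pderiv P) (x l) else 0)"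
      unfolding poly_sum using m by (intro sum.cong) (auto simp: B_node)
    also have "\<dots> = poly Q y"
      using m fin P'_nz by (simp add: c_def)
    finally show "poly Q y = poly (\<Sum>l\<in>I. Polynomial.smult (c l) (B l)) y" ..
  next
    show "degree Q < card (x ` I)"
      using deg inj by (simp add: card_image)
    have "degree (\<Sum>l\<in>I. Polynomial.smult (c l) (B l)) \<le> card I - 1"
      using fin degB by (intro degree_sum_le) (auto intro: order_trans[OF degree_smult_le])
    then show "degree (\<Sum>l\<in>I. Polynomial.smult (c l) (B l)) < card (x ` I)"
      using deg inj by (simp add: card_image)
  qed
  have "coeff Q (card I - 1) = (\<Sum>l\<in>I. c l * coeff (B l) (card I - 1))"
    by (subst interpolation) (simp add: coeff_sum)
  also have "\<dots> = (\<Sum>l\<in>I. c l)"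
    using leadB by simp
  finally show ?thesis by (simp add: c_def)
qed

lemma p_trunc_Suc: "p_trunc a (Suc j) s = p_trunc a j s + a (Suc j) * s ^ Suc j"
  by (simp add: p_trunc_def)

lemma p_trunc_at_root:
  assumes "poly P s = 0" and "degree P = k" and "coeff P k = 1" and "k \<ge> 1"
  shows "p_trunc (coeff P) (k - 1) s = - (s ^ k)"
proof -
  have "p_trunc (coeff P) k s = 0"
    using assms by (simp add: p_trunc_def poly_altdef atMost_atLeast0)
  then show ?thesis
    using p_trunc_Suc[of "coeff P" "k - 1" s] assms by (simp add: eq_neg_iff_add_eq_0)
qed

text \<open>
  At \<open>m = 0\<close> this is Euler's identity for \<open>Q = x\<^sup>k\<^sup>-\<^sup>j\<^sup>-\<^sup>1 p\<^sub>j(x)\<close>. In the induction step the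
  term \<open>-a\<^sub>j b\<^sub>k\<^sub>-\<^sub>1\<close> of the recursion supplies exactly the top monomial \<open>a\<^sub>j s\<^sup>j\<close> by which
  \<open>p\<^sub>j\<close> exceeds \<open>p\<^sub>j\<^sub>-\<^sub>1\<close>, because \<open>p\<^sub>k\<^sub>-\<^sub>1\<close> collapses to \<open>-s\<^sup>k\<close> at the roots.
\<close>
lemma b_shift_closed_form:
  fixes lam :: "nat \<Rightarrow> complex"
  assumes k: "k \<ge> 1" and inj: "inj_on lam {1..k}"
    and P: "P = (\<Prod>l=1..k. [:- lam l, 1:])"
    and j: "j \<le> k - 1"
  shows "b_shift k (coeff P) m j
    = - (\<Sum>l=1..k. lam l ^ (m + k - j - 1)
          * (p_trunc (coeff P) j (lam l) / poly (pderiv P) (lam l)))"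
  using j
proof (induction m arbitrary: j)
  case 0
  define Q where "Q = (\<Sum>i=0..j. monom (coeff P i) (k - j - 1 + i))"
  have "degree Q \<le> k - 1"
    unfolding Q_def using 0 by (intro degree_sum_le) (auto intro!: order_trans[OF degree_monom_le])
  then have degQ: "degree Q < card {1..k}"
    using k by simp
  have "coeff Q (k - 1) = (\<Sum>i=0..j. if i = j then coeff P i else 0)"
    unfolding Q_def coeff_sum using 0 k by (intro sum.cong) auto
  then have coeffQ: "coeff Q (k - 1) = coeff P j"
    by simp
  have "poly Q s = s ^ (k - j - 1) * p_trunc (coeff P) j s" for s
    by (simp add: Q_def p_trunc_def poly_sum poly_monom power_add sum_distrib_left mult_ac)
  then show ?case
    using sum_div_pderiv_eq_coeff[OF _ inj degQ] coeffQ by (simp add: P)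
next
  case (Suc m)
  define d where "d l = poly (pderiv P) (lam l)" for l
  have deg: "degree P = k"
    by (simp add: P degree_prod_eq_sum_degree)
  have monic: "coeff P k = 1"
    using deg lead_coeff_prod[of "\<lambda>l. [:- lam l, 1:]" "{1..k}"] by (simp add: P)
  have root: "poly P (lam l) = 0" if "l \<in> {1..k}" for l
    using that by (auto simp: P poly_prod prod_zero_iff)
  have "b_shift k (coeff P) m (k - 1)
      = - (\<Sum>l=1..k. lam l ^ m * (p_trunc (coeff P) (k - 1) (lam l) / d l))"
    using Suc.IH[of "k - 1"] k by (simp add: d_def)
  also have "\<dots> = (\<Sum>l=1..k. lam l ^ (m + k) / d l)"
    unfolding sum_negf[symmetric] using root deg monic k
    by (intro sum.cong) (simp_all add: p_trunc_at_root[where k = k, simplified] power_add)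
  finally have last: "b_shift k (coeff P) m (k - 1) = (\<Sum>l=1..k. lam l ^ (m + k) / d l)" .
  show ?case
  proof (cases j)
    case 0
    then show ?thesis
      using last k by (simp add: p_trunc_def d_def sum_distrib_left mult_ac)
  next
    case (Suc i)
    have exponent: "Suc m + k - j - 1 + j = m + k" "m + k - i - 1 = Suc m + k - j - 1"
      using Suc Suc.prems k by auto
    have "b_shift k (coeff P) (Suc m) j
        = - (\<Sum>l=1..k. lam l ^ (Suc m + k - j - 1) * (p_trunc (coeff P) i (lam l) / d l))
          - coeff P j * (\<Sum>l=1..k. lam l ^ (Suc m + k - j - 1 + j) / d l)"
      using Suc.IH[of i] Suc Suc.prems last
      by (simp only: exponent) (simp add: d_def)
    also have "\<dots> = - (\<Sum>l=1..k. lam l ^ (Suc m + k - j - 1)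
                        * (p_trunc (coeff P) i (lam l) / d l)
                      + coeff P j * (lam l ^ (Suc m + k - j - 1 + j) / d l))"
      by (simp only: sum.distrib sum_distrib_left) simp
    also have "\<dots> = - (\<Sum>l=1..k. lam l ^ (Suc m + k - j - 1)
                        * (p_trunc (coeff P) j (lam l) / d l))"
      unfolding Suc p_trunc_Suc power_add
      by (intro arg_cong[where f = uminus] sum.cong)
         (simp_all add: add_divide_distrib algebra_simps)
    finally show ?thesis by (simp only: d_def)
  qed
qed

lemma power_times_exp_series_sums:
  fixes x z :: complex
  shows "(\<lambda>n. x ^ (n + e) * c * (z ^ n / fact n)) sums (x ^ e * c * exp (x * z))"
proof -
  have "(\<lambda>n. (x * z) ^ n / fact n) sums exp (x * z)"
    using exp_converges[of "x * z"] by (simp add: scaleR_conv_of_real field_simps)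
  then have "(\<lambda>n. x ^ e * c * ((x * z) ^ n / fact n)) sums (x ^ e * c * exp (x * z))"
    by (rule sums_mult)
  then show ?thesis
    by (simp add: power_add power_mult_distrib mult_ac)
qed

theorem corollary4:
  fixes k :: nat and A :: "complex mat" and lam :: "nat \<Rightarrow> complex"
    and P :: "complex poly" and a :: "nat \<Rightarrow> complex"
  assumes "k \<ge> 1"
    and "A \<in> carrier_mat k k"
    and "P = char_poly A"
    and "a = coeff P"
    and "P = (\<Prod>l=1..k. [:- lam l, 1:])"
    and "inj_on lam {1..k}"
  shows "(\<forall>j\<le>k - 1. \<forall>z.
            summable (\<lambda>n. b_coeff k a j (n + k) * (z ^ n / fact n)) \<and>
            G_gen k a j z =
              - (\<Sum>l=1..k. lam l ^ (k - j - 1) * (p_trunc a j (lam l) / poly (pderiv P) (lam l))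
                          * exp (lam l * z))) \<and>
         (\<forall>j\<le>k - 1. \<forall>n\<ge>k.
            b_coeff k a j n =
              - (\<Sum>l=1..k. lam l ^ (n - j - 1) * (p_trunc a j (lam l) / poly (pderiv P) (lam l))))"
proof -
  define w where "w j l = p_trunc a j (lam l) / poly (pderiv P) (lam l)" for j l
  have closed: "b_coeff k a j n = - (\<Sum>l=1..k. lam l ^ (n - j - 1) * w j l)"
    if "j \<le> k - 1" "n \<ge> k" for j n
    using b_shift_closed_form[OF assms(1) assms(6) assms(5) that(1), of "n - k"] that(2)
    by (simp add: b_coeff_def w_def assms(4))
  have series: "(\<lambda>n. b_coeff k a j (n + k) * (z ^ n / fact n))
      sums (- (\<Sum>l=1..k. lam l ^ (k - j - 1) * w j l * exp (lam l * z)))"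
    if "j \<le> k - 1" for j z
  proof -
    have exponent: "n + k - j - 1 = n + (k - j - 1)" for n
      using that assms(1) by simp
    have "(\<lambda>n. - (\<Sum>l=1..k. lam l ^ (n + (k - j - 1)) * w j l * (z ^ n / fact n)))
        sums (- (\<Sum>l=1..k. lam l ^ (k - j - 1) * w j l * exp (lam l * z)))"
      by (intro sums_minus sums_sum power_times_exp_series_sums)
    moreover have "b_coeff k a j (n + k) * (z ^ n / fact n)
        = - (\<Sum>l=1..k. lam l ^ (n + (k - j - 1)) * w j l * (z ^ n / fact n))" for n
      using closed[OF that, of "n + k"]
      by (simp only: exponent sum_distrib_right mult_minus_left)
    ultimately show ?thesis by (simp only:)
  qed
  show ?thesis
    using closed series unfolding G_gen_def w_def
    by (auto simp: sums_iff)
qed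

end
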